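(* Let $V$ be a finite set. A mapping $(u,v)\mapsto [uv]$ from $V^2$ to $2^V$ satisfies the three conditions (S) for all $a,b,c\in V$ there exists $d\in V$ such that $[ab]\cap [bc]=[bd]$; (T) for all $a,b,c\in V$: if $[ab]\subseteq [ac]$, then $[ab]\cap [bc]=\{b\}$; (U$_1$) for all $a,b,c\in V$: if $[ab]\cap [bc]=\{b\}$, then $[ab]\cup [bc]=[ac]$; if and only if there is a tree $T$ with vertex set $V$ such that $[vw]_T=[vw]$ for all pairs $v,w$ of its vertices.
   Context: A tree is a finite, simple, undirected, connected graph without cycles. $2^V$ denotes the set of all subsets of $V$. The value of the mapping at the ordered pair $(u,v)$ is denoted $[uv]$ (no symmetry is assumed a priori, and $u=v$ is allowed). For vertices $u,v$ (not necessarily distinct) of a tree $T$, $[uv]_T$ denotes the set of all vertices on the path in $T$ that joins $u$ and $v$, including $u$ and $v$ themselves (so $[uu]_T=\{u\}$). *)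

theory Defs
  imports Main
begin

text \<open>
  A simple undirected graph is given by its vertex set \<open>V\<close> and its edge set \<open>E\<close>; an edge is a
  two-element set of vertices, so loops and parallel edges are excluded.
\<close>

definition simple_graph :: "'a set \<Rightarrow> 'a set set \<Rightarrow> bool" where
  "simple_graph V E \<longleftrightarrow> (\<forall>e\<in>E. e \<subseteq> V \<and> card e = 2)"

text \<open>A path is the list of its vertices; \<open>[v]\<close> is the path from \<open>v\<close> to \<open>v\<close>.\<close>

definition graph_path :: "'a set \<Rightarrow> 'a set set \<Rightarrow> 'a list \<Rightarrow> bool" where
  "graph_path V E p \<longleftrightarrow>
     p \<noteq> [] \<and> set p \<subseteq> V \<and> distinct p \<and> successively (\<lambda>x y. {x, y} \<in> E) p"

definition graph_path_between :: "'a set \<Rightarrow> 'a set set \<Rightarrow> 'a \<Rightarrow> 'a \<Rightarrow> 'a list \<Rightarrow> bool" where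
  "graph_path_between V E u v p \<longleftrightarrow> graph_path V E p \<and> hd p = u \<and> last p = v"

text \<open>A cycle is listed without repeating its first vertex.\<close>

definition graph_cycle :: "'a set \<Rightarrow> 'a set set \<Rightarrow> 'a list \<Rightarrow> bool" where
  "graph_cycle V E p \<longleftrightarrow> graph_path V E p \<and> 3 \<le> length p \<and> {last p, hd p} \<in> E"

text \<open>The graph without vertices counts as connected, hence as a tree.\<close>

definition graph_connected :: "'a set \<Rightarrow> 'a set set \<Rightarrow> bool" where
  "graph_connected V E \<longleftrightarrow> (\<forall>u\<in>V. \<forall>v\<in>V. \<exists>p. graph_path_between V E u v p)"

definition is_tree :: "'a set \<Rightarrow> 'a set set \<Rightarrow> bool" where
  "is_tree V E \<longleftrightarrow>
     finite V \<and> simple_graph V E \<and> graph_connected V E \<and> (\<nexists>p. graph_cycle V E p)"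

text \<open>Meant for trees and vertices \<open>u\<close>, \<open>v\<close> of them, where the path joining \<open>u\<close> and \<open>v\<close> is unique.\<close>

definition tree_interval :: "'a set \<Rightarrow> 'a set set \<Rightarrow> 'a \<Rightarrow> 'a \<Rightarrow> 'a set" where
  "tree_interval V E u v = set (THE p. graph_path_between V E u v p)"

end

theory Submission
  imports Defs
begin

text \<open>
  Under (S), (T) and (U\<open>\<^sub>1\<close>) the mapping is symmetric, and \<open>b \<in> [ac]\<close> means that \<open>[ac]\<close> is the
  union of \<open>[ab]\<close> and \<open>[bc]\<close>, which then meet only in \<open>b\<close>. Join \<open>u \<noteq> v\<close> by an edge whenever
  \<open>[uv] = {u, v}\<close>. By (U\<open>\<^sub>1\<close>) the vertices of any path from \<open>u\<close> to \<open>v\<close> form exactly \<open>[uv]\<close>, so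
  there are no cycles and paths are unique; splitting intervals at inner points yields a path
  between any two vertices. Conversely, in a tree, (T) and (U\<open>\<^sub>1\<close>) follow by cutting and
  concatenating paths, and in (S) one takes for \<open>d\<close> the last vertex of the path from \<open>b\<close> to \<open>a\<close>
  that lies on the path from \<open>b\<close> to \<open>c\<close>.
\<close>

section \<open>Paths\<close>

lemma graph_path_between_singleton:
  "u \<in> V \<Longrightarrow> graph_path_between V E u u [u]"
  by (simp add: graph_path_between_def graph_path_def)

lemma graph_path_between_ends:
  assumes "graph_path_between V E u v p"
  shows "u \<in> set p" "v \<in> set p" "set p \<subseteq> V"
  using assms by (auto simp: graph_path_between_def graph_path_def)

lemma graph_path_between_Cons:
  assumes "q \<noteq> []"
  shows "graph_path_between V E u v (w # q) \<longleftrightarrow>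
    w = u \<and> u \<in> V \<and> u \<notin> set q \<and> {u, hd q} \<in> E \<and> graph_path_between V E (hd q) v q"
  using assms by (auto simp: graph_path_between_def graph_path_def successively_Cons)

lemma graph_path_between_refl:
  assumes "graph_path_between V E u u p"
  shows "p = [u]"
proof (cases p)
  case Nil
  then show ?thesis using assms by (simp add: graph_path_between_def graph_path_def)
next
  case (Cons x q)
  then show ?thesis using assms
    by (cases "q = []") (auto simp: graph_path_between_def graph_path_def)
qed

lemma graph_path_between_cases:
  assumes "graph_path_between V E u v p"
  obtains "u = v" "p = [u]"
  | q where "u \<noteq> v" "q \<noteq> []" "p = u # q" "u \<in> V" "u \<notin> set q" "{u, hd q} \<in> E"
      "graph_path_between V E (hd q) v q"
proof (cases "u = v")
  case True
  then show ?thesis using graph_path_between_refl assms that(1) by metis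
next
  case False
  from assms obtain x q where p: "p = x # q"
    by (cases p) (auto simp: graph_path_between_def graph_path_def)
  with assms False have "q \<noteq> []"
    by (auto simp: graph_path_between_def)
  then show ?thesis
    using that(2)[of q] False assms graph_path_between_Cons[of q V E u v x] p by auto
qed

lemma successively_edge_rev:
  "successively (\<lambda>x y. {x, y} \<in> E) (rev p) \<longleftrightarrow> successively (\<lambda>x y. {x, y} \<in> E) p"
  by (simp add: insert_commute)

lemma graph_path_between_rev:
  assumes "graph_path_between V E u v p"
  shows "graph_path_between V E v u (rev p)"
  using assms successively_edge_rev[of E p]
  by (auto simp: graph_path_between_def graph_path_def hd_rev last_rev)

text \<open>Both pieces contain \<open>w\<close>, and their being paths already keeps
  \<open>w\<close> out of \<open>p\<close> and of \<open>q\<close>; what remains to be required is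
  that \<open>p\<close> and \<open>q\<close> are disjoint.\<close>

lemma graph_path_between_split:
  "graph_path_between V E u v (p @ w # q) \<longleftrightarrow>
    graph_path_between V E u w (p @ [w]) \<and> graph_path_between V E w v (w # q) \<and>
    set p \<inter> set q = {}"
  by (auto simp: graph_path_between_def graph_path_def successively_append_iff hd_append)

lemma graph_path_between_join:
  assumes "graph_path_between V E u w p" "graph_path_between V E w v q" "set p \<inter> set q = {w}"
  shows "\<exists>r. graph_path_between V E u v r \<and> set r = set p \<union> set q"
proof -
  obtain p' where p: "p = p' @ [w]"
    using assms(1) by (metis append_butlast_last_id graph_path_between_def graph_path_def)
  obtain q' where q: "q = w # q'"
    using assms(2) by (metis list.collapse graph_path_between_def graph_path_def)
  have "w \<notin> set p'"
    using assms(1) p by (auto simp: graph_path_between_def graph_path_def)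
  then have "set p' \<inter> set q' = {}" using assms(3) p q by auto
  then have "graph_path_between V E u v (p' @ w # q')"
    using assms(1,2) p q by (subst graph_path_between_split) simp
  then show ?thesis using p q by (intro exI[of _ "p' @ w # q'"]) auto
qed

section \<open>Intervals of a tree\<close>

text \<open>If the second vertices agree, induction applies to the tails. Otherwise the first path
  is followed until it hits the second, and returning to \<open>u\<close> along the second closes a
  cycle.\<close>

lemma graph_path_between_unique:
  assumes acyclic: "\<nexists>c. graph_cycle V E c"
  shows "graph_path_between V E u v p \<Longrightarrow> graph_path_between V E u v q \<Longrightarrow> p = q"
proof (induction p arbitrary: u q)
  case Nil
  then show ?case by (simp add: graph_path_between_def graph_path_def)
next
  case (Cons w p)
  show ?case
  proof (cases "u = v")
    case True
    then show ?thesis using Cons.prems graph_path_between_refl by metis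
  next
    case False
    have p: "w = u" "p \<noteq> []" "u \<in> V" "u \<notin> set p" "{u, hd p} \<in> E"
      "graph_path_between V E (hd p) v p"
      using Cons.prems(1) False by (auto elim: graph_path_between_cases)
    obtain r where r: "q = u # r" "r \<noteq> []" "u \<notin> set r" "{u, hd r} \<in> E"
      "graph_path_between V E (hd r) v r"
      using Cons.prems(2) False by (auto elim: graph_path_between_cases)
    show ?thesis
    proof (cases "hd p = hd r")
      case True
      then show ?thesis using Cons.IH p r by auto
    next
      case heads: False
      have "\<exists>z\<in>set p. z \<in> set r"
        using graph_path_between_ends p(6) r(5) by metis
      then obtain p1 z p2 where pz: "p = p1 @ z # p2" "z \<in> set r" "\<forall>y\<in>set p1. y \<notin> set r"
        using split_list_first_prop[of p "\<lambda>z. z \<in> set r"] by auto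
      obtain r1 r2 where rz: "r = r1 @ z # r2"
        using pz(2) by (meson split_list)
      \<comment> \<open>The two paths diverge at \<open>u\<close> and meet again at \<open>z\<close> for the first time.\<close>
      have 1: "graph_path_between V E (hd p) z (p1 @ [z])"
        using p(6) unfolding pz(1) by (subst (asm) graph_path_between_split) simp
      have "graph_path_between V E (hd r) z (r1 @ [z])"
        using r(5) by (subst (asm) rz, subst (asm) graph_path_between_split) simp
      then have 2: "graph_path_between V E z (hd r) (z # rev r1)"
        using graph_path_between_rev by fastforce
      have "set p1 \<inter> set (rev r1) = {}" using pz(3) rz by auto
      then have "graph_path_between V E (hd p) (hd r) (p1 @ z # rev r1)"
        using 1 2 by (subst graph_path_between_split) simp
      moreover have "hd (p1 @ z # rev r1) = hd p" using pz(1) by (cases p1) auto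
      moreover have "u \<notin> set (p1 @ z # rev r1)" using p(4) r(3) pz(1) rz by auto
      ultimately have c: "graph_path_between V E u (hd r) (u # p1 @ z # rev r1)"
        using p(3,5) by (subst graph_path_between_Cons) auto
      \<comment> \<open>As the second vertices differ, \<open>z\<close> cannot be both of them;
        hence the closed walk has at least three vertices.\<close>
      have "p1 \<noteq> [] \<or> r1 \<noteq> []" using heads pz(1) rz by auto
      then have "3 \<le> length (u # p1 @ z # rev r1)"
        by (cases p1; cases r1) auto
      then have "graph_cycle V E (u # p1 @ z # rev r1)"
        using c r(4) by (simp add: graph_cycle_def graph_path_between_def insert_commute)
      then show ?thesis using acyclic by blast
    qed
  qed
qed

context
  fixes V :: "'a set" and E :: "'a set set"
  assumes tree: "is_tree V E"
begin

lemma tree_path_unique: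
  "graph_path_between V E u v p \<Longrightarrow> graph_path_between V E u v q \<Longrightarrow> p = q"
  using tree graph_path_between_unique[of V E] by (auto simp: is_tree_def)

lemma tree_interval_eq:
  assumes "graph_path_between V E u v p"
  shows "tree_interval V E u v = set p"
  using assms tree_path_unique unfolding tree_interval_def by (metis the_equality)

lemma tree_path_exists:
  assumes "u \<in> V" "v \<in> V"
  obtains p where "graph_path_between V E u v p" "tree_interval V E u v = set p"
  using assms tree tree_interval_eq by (force simp: is_tree_def graph_connected_def)

lemma tree_interval_commute:
  assumes "u \<in> V" "v \<in> V"
  shows "tree_interval V E u v = tree_interval V E v u"
  using assms tree_path_exists[of u v] graph_path_between_rev tree_interval_eq set_rev by metis

lemma tree_interval_right:
  assumes "u \<in> V" "v \<in> V"
  shows "v \<in> tree_interval V E u v"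
  using assms tree_path_exists[of u v] graph_path_between_ends(2) by metis

text \<open>The path is cut at \<open>w\<close>: by uniqueness the pieces are the paths defining the
  two smaller intervals, and distinctness leaves only \<open>w\<close> in common.\<close>

lemma tree_interval_split:
  assumes "u \<in> V" "v \<in> V" "w \<in> tree_interval V E u v"
  shows "tree_interval V E u w \<union> tree_interval V E w v = tree_interval V E u v"
    and "tree_interval V E u w \<inter> tree_interval V E w v = {w}"
proof -
  obtain p where p: "graph_path_between V E u v p" "tree_interval V E u v = set p"
    using assms tree_path_exists by metis
  obtain q r where qr: "p = q @ w # r"
    using assms(3) p(2) by (metis split_list)
  have *: "graph_path_between V E u w (q @ [w])" "graph_path_between V E w v (w # r)"
    "set q \<inter> set r = {}"
    using p(1) unfolding qr graph_path_between_split[of V E u v q w r] by simp_all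
  then have sets: "tree_interval V E u w = set (q @ [w])" "tree_interval V E w v = set (w # r)"
    using tree_interval_eq by blast+
  show "tree_interval V E u w \<union> tree_interval V E w v = tree_interval V E u v"
    unfolding sets p(2) qr by auto
  show "tree_interval V E u w \<inter> tree_interval V E w v = {w}"
    unfolding sets using *(3) by auto
qed

lemma tree_interval_join:
  assumes "u \<in> V" "v \<in> V" "w \<in> V" "tree_interval V E u w \<inter> tree_interval V E w v = {w}"
  shows "tree_interval V E u w \<union> tree_interval V E w v = tree_interval V E u v"
proof -
  obtain p where p: "graph_path_between V E u w p" "tree_interval V E u w = set p"
    using assms tree_path_exists by metis
  obtain q where q: "graph_path_between V E w v q" "tree_interval V E w v = set q"
    using assms tree_path_exists by metis
  show ?thesis
    using graph_path_between_join[OF p(1) q(1)] assms(4) p(2) q(2) tree_interval_eq by metis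
qed

text \<open>The inclusion puts \<open>b\<close> on the path from \<open>a\<close> to
  \<open>c\<close>, which is then cut there.\<close>

lemma tree_interval_subset:
  assumes "a \<in> V" "b \<in> V" "c \<in> V" "tree_interval V E a b \<subseteq> tree_interval V E a c"
  shows "tree_interval V E a b \<inter> tree_interval V E b c = {b}"
  using assms tree_interval_right tree_interval_split(2) by blast

lemma tree_interval_Int:
  assumes "a \<in> V" "b \<in> V" "c \<in> V"
  shows "\<exists>d\<in>V. tree_interval V E a b \<inter> tree_interval V E b c = tree_interval V E b d"
proof -
  obtain p where p: "graph_path_between V E b a p" "tree_interval V E b a = set p"
    using assms tree_path_exists by metis
  have "b \<in> tree_interval V E b c"
    using assms tree_interval_commute tree_interval_right by metis
  then have "\<exists>x\<in>set p. x \<in> tree_interval V E b c"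
    using graph_path_between_ends(1)[OF p(1)] by blast
  then obtain q d r where d: "p = q @ d # r" "d \<in> tree_interval V E b c"
    "\<forall>x\<in>set r. x \<notin> tree_interval V E b c"
    using split_list_last_prop[of p "\<lambda>x. x \<in> tree_interval V E b c"] by auto
  \<comment> \<open>Since \<open>p\<close> starts at \<open>b\<close>, its part up to
    \<open>d\<close> is the interval from \<open>b\<close> to \<open>d\<close>. This lies in the
    interval from \<open>b\<close> to \<open>c\<close> because \<open>d\<close> does, whereas
    \<open>r\<close> avoids that interval by the choice of \<open>d\<close>.\<close>
  have "tree_interval V E b d = set (q @ [d])"
    using p(1) tree_interval_eq unfolding d(1) graph_path_between_split[of V E b a q d r] by blast
  moreover have "tree_interval V E b d \<subseteq> tree_interval V E b c"
    using assms d(2) tree_interval_split(1) by blast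
  moreover have "tree_interval V E a b = set (q @ [d]) \<union> set r"
    using assms p(2) d(1) tree_interval_commute[of a b] by auto
  ultimately have "tree_interval V E a b \<inter> tree_interval V E b c = tree_interval V E b d"
    using d(3) by auto
  moreover have "d \<in> V" using graph_path_between_ends(3)[OF p(1)] d(1) by auto
  ultimately show ?thesis by blast
qed

end

section \<open>The tree of an interval mapping\<close>

locale interval_mapping =
  fixes V :: "'a set" and J :: "'a \<Rightarrow> 'a \<Rightarrow> 'a set"
  assumes finite_V: "finite V"
    and subset_V: "u \<in> V \<Longrightarrow> v \<in> V \<Longrightarrow> J u v \<subseteq> V"
    and S: "a \<in> V \<Longrightarrow> b \<in> V \<Longrightarrow> c \<in> V \<Longrightarrow> \<exists>d\<in>V. J a b \<inter> J b c = J b d"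
    and T: "a \<in> V \<Longrightarrow> b \<in> V \<Longrightarrow> c \<in> V \<Longrightarrow> J a b \<subseteq> J a c \<Longrightarrow> J a b \<inter> J b c = {b}"
    and U1: "a \<in> V \<Longrightarrow> b \<in> V \<Longrightarrow> c \<in> V \<Longrightarrow> J a b \<inter> J b c = {b} \<Longrightarrow> J a b \<union> J b c = J a c"
begin

section \<open>Symmetry and splitting of intervals\<close>

lemma self: "a \<in> V \<Longrightarrow> J a a = {a}"
  using T[of a a a] by auto

lemma right: "a \<in> V \<Longrightarrow> b \<in> V \<Longrightarrow> b \<in> J a b"
  using T[of a b b] by auto

text \<open>In (S) at \<open>a, a, b\<close> the witness \<open>d\<close> lies in
  \<open>J a d\<close>, hence in \<open>J a a = {a}\<close>; so \<open>d = a\<close>, and it lies in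
  \<open>J a b\<close>.\<close>

lemma left:
  assumes "a \<in> V" "b \<in> V"
  shows "a \<in> J a b"
proof -
  obtain d where d: "d \<in> V" "J a a \<inter> J a b = J a d"
    using S[OF assms(1,1,2)] by metis
  have "d \<in> J a a \<inter> J a b" unfolding d(2) by (rule right[OF assms(1) d(1)])
  then show ?thesis unfolding self[OF assms(1)] by auto
qed

text \<open>By (S) the set \<open>J a b \<inter> J b a\<close> is some \<open>J b d\<close>. It
  contains \<open>a\<close>, as does \<open>J d a\<close>, but by (T) these two share only
  \<open>d\<close>. So \<open>d = a\<close>, which gives one inclusion; exchanging \<open>a\<close>
  and \<open>b\<close> gives the other.\<close>

lemma commute:
  assumes "a \<in> V" "b \<in> V"
  shows "J a b = J b a"
proof -
  have "J b a \<subseteq> J a b" if V: "a \<in> V" "b \<in> V" for a b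
  proof -
    obtain d where d: "d \<in> V" "J a b \<inter> J b a = J b d"
      using S V by blast
    have "J b d \<inter> J d a = {d}" using T[of b d a] d V by blast
    moreover have "a \<in> J b d" using d(2) V left right by blast
    ultimately have "a = d" using V d(1) right[of d a] by blast
    then show ?thesis using d(2) by blast
  qed
  then show ?thesis using assms by blast
qed

text \<open>The argument for symmetry again: (S) writes \<open>J b a \<inter> J a c\<close> as
  \<open>J a d\<close>, and (T) forces \<open>d = b\<close> because \<open>b\<close> lies in both
  \<open>J a d\<close> and \<open>J d b\<close>.\<close>

lemma mem_imp_subset:
  assumes "a \<in> V" "b \<in> V" "c \<in> V" "b \<in> J a c"
  shows "J a b \<subseteq> J a c"
proof -
  obtain d where d: "d \<in> V" "J b a \<inter> J a c = J a d"
    using S assms by blast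
  have "J a d \<inter> J d b = {d}" using T[of a d b] d assms commute[of a b] by blast
  moreover have "b \<in> J a d" using d(2) assms left by blast
  ultimately have "b = d" using assms d(1) right[of d b] by blast
  then show ?thesis using d(2) by blast
qed

text \<open>Membership yields the inclusion that (T) asks for, and the conclusion of (T) is the
  hypothesis of (U1).\<close>

lemma split:
  assumes "a \<in> V" "b \<in> V" "c \<in> V" "b \<in> J a c"
  shows "J a b \<inter> J b c = {b}" "J a b \<union> J b c = J a c"
proof -
  show "J a b \<inter> J b c = {b}" by (rule T[OF assms(1-3) mem_imp_subset[OF assms]])
  then show "J a b \<union> J b c = J a c" by (rule U1[OF assms(1-3)])
qed

section \<open>The adjacency graph and its paths\<close>

definition adj :: "'a set set" where
  "adj = {{u, v} | u v. u \<in> V \<and> v \<in> V \<and> u \<noteq> v \<and> J u v = {u, v}}"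

lemma adj_iff: "{u, v} \<in> adj \<longleftrightarrow> u \<in> V \<and> v \<in> V \<and> u \<noteq> v \<and> J u v = {u, v}"
  using commute by (auto simp: adj_def doubleton_eq_iff)

text \<open>The first edge spans a two-point interval, and by distinctness \<open>u\<close> is
  absent from the rest of the path, which fills \<open>J (hd p) v\<close> by induction. The two
  intervals thus meet in \<open>hd p\<close> only, and (U1) glues them.\<close>

lemma set_path:
  "graph_path_between V adj u v p \<Longrightarrow> set p = J u v"
proof (induction p arbitrary: u)
  case Nil
  then show ?case by (simp add: graph_path_between_def graph_path_def)
next
  case (Cons w p)
  from Cons.prems show ?case
  proof (cases rule: graph_path_between_cases)
    case 1
    then show ?thesis using graph_path_between_ends[OF Cons.prems] self by auto
  next
    case (2 q)
    then have q: "set p = J (hd p) v" "w = u" "q = p" using Cons.IH by auto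
    have V: "hd p \<in> V" "v \<in> V"
      using 2 q graph_path_between_ends[of V adj "hd p" v p] by auto
    have "J u (hd p) = {u, hd p}" using 2 q adj_iff by auto
    moreover from this have "J u (hd p) \<inter> J (hd p) v = {hd p}"
      using q 2 left[OF V] by auto
    ultimately have "J u v = {u, hd p} \<union> J (hd p) v" using U1 2(4) V by metis
    then show ?thesis using q left[OF V] by auto
  qed
qed

lemma path_exists:
  assumes "u \<in> V" "v \<in> V"
  shows "\<exists>p. graph_path_between V adj u v p"
  using assms
proof (induction "card (J u v)" arbitrary: u v rule: less_induct)
  case less
  consider "u = v" | "u \<noteq> v" "J u v = {u, v}" | w where "w \<in> J u v" "w \<noteq> u" "w \<noteq> v"
    using left right less.prems by blast
  then show ?case
  proof cases
    case 1
    then show ?thesis using graph_path_between_singleton less.prems by metis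
  next
    case 2
    then have "graph_path_between V adj u v [u, v]"
      using less.prems adj_iff by (simp add: graph_path_between_def graph_path_def)
    then show ?thesis by blast
  next
    case (3 w)
    have w: "w \<in> V" using 3 subset_V less.prems by blast
    have s: "J u w \<inter> J w v = {w}" "J u w \<union> J w v = J u v"
      using split[OF less.prems(1) w less.prems(2) 3(1)] .
    \<comment> \<open>The pieces share only \<open>w\<close>, so neither contains the far endpoint;
      both are proper subsets of \<open>J u v\<close>, and the induction on cardinality
      applies.\<close>
    have "v \<notin> J u w" "u \<notin> J w v"
      using s(1) 3(2,3) left[of u w] right[of w v] w less.prems by auto
    then have "J u w \<subset> J u v" "J w v \<subset> J u v"
      using s(2) left right less.prems by blast+
    moreover have "finite (J u v)" using subset_V less.prems finite_V finite_subset by metis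
    ultimately have "card (J u w) < card (J u v)" "card (J w v) < card (J u v)"
      by (simp_all add: psubset_card_mono)
    then obtain p q where "graph_path_between V adj u w p" "graph_path_between V adj w v q"
      using less w by metis
    then show ?thesis using graph_path_between_join s(1) set_path by metis
  qed
qed

lemma is_tree_adj: "is_tree V adj"
proof -
  have "simple_graph V adj" by (auto simp: simple_graph_def adj_def)
  moreover have "\<not> graph_cycle V adj c" for c
  proof
    assume c: "graph_cycle V adj c"
    \<comment> \<open>Read as a path, the cycle fills the interval between its ends. These are
      adjacent, so the interval has two elements, fewer than the cycle has vertices.\<close>
    then have "graph_path_between V adj (hd c) (last c) c"
      by (simp add: graph_cycle_def graph_path_between_def)
    then have "set c = J (hd c) (last c)" by (rule set_path)
    moreover have "{hd c, last c} \<in> adj" using c by (simp add: graph_cycle_def insert_commute)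
    ultimately have "card (set c) = 2" using adj_iff by simp
    moreover have "card (set c) = length c"
      using c by (simp add: graph_cycle_def graph_path_def distinct_card)
    ultimately show False using c by (simp add: graph_cycle_def)
  qed
  ultimately show ?thesis
    using finite_V path_exists by (simp add: is_tree_def graph_connected_def)
qed

lemma tree_interval_adj:
  assumes "u \<in> V" "v \<in> V"
  shows "tree_interval V adj u v = J u v"
  using path_exists[OF assms] tree_interval_eq[OF is_tree_adj] set_path by metis

end

theorem theorem1:
  fixes V :: "'a set" and J :: "'a \<Rightarrow> 'a \<Rightarrow> 'a set"
  assumes "finite V"
    and "\<And>u v. u \<in> V \<Longrightarrow> v \<in> V \<Longrightarrow> J u v \<subseteq> V"
  shows "((\<forall>a\<in>V. \<forall>b\<in>V. \<forall>c\<in>V. \<exists>d\<in>V. J a b \<inter> J b c = J b d) \<and>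
          (\<forall>a\<in>V. \<forall>b\<in>V. \<forall>c\<in>V. J a b \<subseteq> J a c \<longrightarrow> J a b \<inter> J b c = {b}) \<and>
          (\<forall>a\<in>V. \<forall>b\<in>V. \<forall>c\<in>V. J a b \<inter> J b c = {b} \<longrightarrow> J a b \<union> J b c = J a c))
     \<longleftrightarrow> (\<exists>E. is_tree V E \<and> (\<forall>v\<in>V. \<forall>w\<in>V. tree_interval V E v w = J v w))"
    (is "?axioms \<longleftrightarrow> ?tree")
proof
  assume ?axioms
  then interpret interval_mapping V J
    using assms by (intro interval_mapping.intro) simp_all
  show ?tree using is_tree_adj tree_interval_adj by (intro exI[of _ adj]) simp
next
  assume ?tree
  then obtain E where tree: "is_tree V E"
    and J: "\<And>v w. v \<in> V \<Longrightarrow> w \<in> V \<Longrightarrow> J v w = tree_interval V E v w"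
    by auto
  show ?axioms
  proof (intro conjI ballI impI)
    fix a b c
    assume V: "a \<in> V" "b \<in> V" "c \<in> V"
    show "\<exists>d\<in>V. J a b \<inter> J b c = J b d"
      using tree_interval_Int[OF tree V] V J by simp
    show "J a b \<inter> J b c = {b}" if "J a b \<subseteq> J a c"
      using tree_interval_subset[OF tree V] that V J by simp
    \<comment> \<open>\<open>tree_interval_join\<close> expects the middle vertex last, hence the
      permuted membership facts.\<close>
    show "J a b \<union> J b c = J a c" if "J a b \<inter> J b c = {b}"
      using tree_interval_join[OF tree V(1,3,2)] that V J by simp
  qed
qed

end
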